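(* Consider any exact dynamic predecessor or rank structure obtained by a $\beta$-ary levelled decomposition with $h+1$ active levels. There exists a set of live keys and a query $q$ for which the structure must inspect all $h+1$ active levels. Consequently, the additive query overhead in this family is $\Omega(h)=\Omega(\log_\beta n)$.
   Context: A $\beta$-ary levelled decomposition of a dynamic ordered set of $n$ live keys distributes the live keys among levels $L_0,\dots,L_h$ ($h=\Theta(\log_\beta n)$ in the worst case), each active level storing its keys in a separate structure; a query's execution depends only on the contents of the levels it inspects. An exact structure always returns the correct predecessor $\max\{x\text{ live}:x\le q\}$ (resp. rank).
   Formalization: The decomposition is additionally assumed to place keys independently of their order (possible states are closed under renaming keys); if levels held consecutive key ranges, a search over the levels would answer predecessor queries inspecting only O(log h) levels, so the claim would fail. *)

theory Defs
  imports Complex_Main "HOL-Library.Landau_Symbols" "HOL-Library.Disjoint_Sets"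
begin

text \<open>
  A state of a levelled decomposition assigns to each level index the set of live keys stored
  there.  Since the lower bound is only about which levels are looked at, reading a level is taken
  to reveal its whole key set, whatever structure it is kept in.
\<close>

type_synonym 'k levels = "nat \<Rightarrow> 'k set"

definition live :: "'k levels \<Rightarrow> 'k set" where
  "live L = (\<Union>i. L i)"

definition active :: "'k levels \<Rightarrow> nat set" where
  "active L = {i. L i \<noteq> {}}"

text \<open>
  Level \<open>i\<close> holds at most \<open>C * \<beta>^(i+1)\<close> keys (up to \<open>\<beta>\<close> blocks of size \<open>O(\<beta>^i)\<close>), and it is
  in use only if the total number \<open>n\<close> of live keys is at least \<open>c * \<beta>^i\<close>; so the highest level in
  use has index at most \<open>log \<beta> n + O(1)\<close>.
\<close>

definition levelled_state :: "real \<Rightarrow> real \<Rightarrow> nat \<Rightarrow> 'k levels \<Rightarrow> bool" where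
  "levelled_state c C \<beta> L \<longleftrightarrow>
     finite (live L) \<and> disjoint_family L \<and>
     (\<forall>i. real (card (L i)) \<le> C * real \<beta> ^ (i + 1)) \<and>
     (\<forall>i\<in>active L. c * real \<beta> ^ i \<le> real (card (live L)))"

text \<open>
  \<open>R\<close> is the set of states that can arise under insertions and deletions.  Closure under
  renaming of keys says that the level of a key is determined by the update history and not by the
  key's position in the order.  It is indispensable: if the levels were consecutive key ranges, a
  binary search over the levels would answer predecessor queries with few inspections.
  The last clause is the worst case for the number of levels: every number of simultaneously
  active levels does occur.
\<close>

definition levelled_decomposition ::
    "real \<Rightarrow> real \<Rightarrow> nat \<Rightarrow> ('k::linorder) levels set \<Rightarrow> bool" where
  "levelled_decomposition c C \<beta> R \<longleftrightarrow>
     2 \<le> \<beta> \<and> 0 < c \<and>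
     (\<forall>L\<in>R. levelled_state c C \<beta> L) \<and>
     (\<lambda>i. {}) \<in> R \<and>
     (\<forall>L\<in>R. \<forall>x. x \<notin> live L \<longrightarrow> (\<exists>L'\<in>R. live L' = insert x (live L))) \<and>
     (\<forall>L\<in>R. \<forall>x\<in>live L. \<exists>L'\<in>R. live L' = live L - {x}) \<and>
     (\<forall>L\<in>R. \<forall>\<pi>. bij \<pi> \<longrightarrow> (\<lambda>i. \<pi> ` L i) \<in> R) \<and>
     (\<forall>h. \<exists>L\<in>R. active L = {..h})"

datatype problem = Predecessor | Rank

datatype 'k answer = Pred_Answer "'k option" | Rank_Answer nat

fun correct_answer :: "problem \<Rightarrow> ('k::linorder) set \<Rightarrow> 'k \<Rightarrow> 'k answer" where
  "correct_answer Predecessor K q =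
     Pred_Answer (if \<exists>x\<in>K. x \<le> q then Some (Max {x \<in> K. x \<le> q}) else None)"
| "correct_answer Rank K q = Rank_Answer (card {x \<in> K. x \<le> q})"

record 'k query_structure =
  answer :: "'k levels \<Rightarrow> 'k \<Rightarrow> 'k answer"
  inspected :: "'k levels \<Rightarrow> 'k \<Rightarrow> nat set"

definition exact :: "problem \<Rightarrow> ('k::linorder) levels set \<Rightarrow> 'k query_structure \<Rightarrow> bool" where
  "exact p R S \<longleftrightarrow> (\<forall>L\<in>R. \<forall>q. answer S L q = correct_answer p (live L) q)"

text \<open>
  The comparison is restricted to states with the same level sizes, so a query may use
  the sizes (in particular, which levels are active) as bookkeeping information without this
  counting as an inspection.  This admits more structures than demanding the implication for all
  pairs of states.
\<close>

definition depends_on_inspected ::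
    "('k::linorder) levels set \<Rightarrow> 'k query_structure \<Rightarrow> bool" where
  "depends_on_inspected R S \<longleftrightarrow>
     (\<forall>L\<in>R. \<forall>L'\<in>R. \<forall>q.
        (\<forall>i. card (L i) = card (L' i)) \<and> (\<forall>i\<in>inspected S L q. L i = L' i) \<longrightarrow>
        inspected S L' q = inspected S L q \<and> answer S L' q = answer S L q)"

text \<open>
  Worst-case quantities are taken over all states with at most \<open>n\<close> live keys.  For exactly
  \<open>n\<close> keys the number of active levels may be small: keeping keys according to the base-\<open>\<beta>\<close>
  digits of \<open>n\<close> leaves a single active level when \<open>n\<close> is a power of \<open>\<beta>\<close>.
  The suprema below are over bounded sets of naturals for every levelled decomposition.
\<close>

definition height :: "'k levels set \<Rightarrow> nat \<Rightarrow> nat" where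
  "height R n = Sup {h. \<exists>L\<in>R. card (live L) \<le> n \<and> active L = {..h}}"

text \<open>
  A structure that is not decomposed pays for one inspection; the additive overhead counts the
  active levels inspected beyond the first.
\<close>

definition overhead :: "'k levels set \<Rightarrow> 'k query_structure \<Rightarrow> nat \<Rightarrow> nat" where
  "overhead R S n =
     Sup {card (inspected S L q \<inter> active L) - 1 | L q. L \<in> R \<and> card (live L) \<le> n}"

text \<open>
  The asymptotic regime in which \<open>log \<beta> n\<close> tends to infinity, with \<open>\<beta>\<close> ranging over \<open>B\<close>.
  Constants hidden by Landau symbols along this filter do not depend on \<open>\<beta>\<close>; for \<open>B = {\<beta>}\<close> it
  amounts to \<open>n\<close> tending to infinity with \<open>\<beta>\<close> fixed.
\<close>

definition many_levels :: "nat set \<Rightarrow> (nat \<times> nat) filter" where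
  "many_levels B =
     inf (filtercomap (\<lambda>(\<beta>, n). log (real \<beta>) (real n)) at_top) (principal (B \<times> UNIV))"

end

theory Submission
  imports Defs "HOL-Combinatorics.Transposition"
begin

text \<open>
  Adversary argument.  Let the query \<open>q\<close> be a dead key below all live keys, so that its predecessor
  is undefined and its rank is \<open>0\<close>.  If some active level is not inspected, exchanging one of its
  keys for \<open>q\<close> gives a reachable state that looks the same to the query but in which
  \<open>q\<close> is its own predecessor and has rank \<open>1\<close>.  A suitable renaming of keys brings every reachable
  state into this position, so the overhead is at least the height.  The height is
  \<open>log \<beta> n + O(1)\<close> uniformly in \<open>\<beta>\<close>, since \<open>h + 1\<close> levels hold at most
  \<open>C * \<beta>^(h+2)\<close> keys and the top one needs \<open>c * \<beta>^h\<close> of them.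
\<close>

section \<open>Reachable states\<close>

lemma live_image: "live (\<lambda>i. \<pi> ` L i) = \<pi> ` live L"
  by (auto simp: live_def)

lemma active_image: "active (\<lambda>i. \<pi> ` L i) = active L"
  by (simp add: active_def)

text \<open>Picking one key per active level is injective because the levels are disjoint. This
  bound is what makes the suprema in \<open>height\<close> and \<open>overhead\<close> suprema of
  bounded sets.\<close>

lemma card_active_le_card_live:
  assumes "finite (live L)" "disjoint_family L"
  shows "finite (active L) \<and> card (active L) \<le> card (live L)"
proof -
  define f where "f i = (SOME x. x \<in> L i)" for i
  have f: "f i \<in> L i" if "i \<in> active L" for i
    using that unfolding active_def f_def by (auto intro: someI_ex)
  have "inj_on f (active L)"
  proof (rule inj_onI)
    fix i j assume "i \<in> active L" "j \<in> active L" "f i = f j"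
    then have "f i \<in> L i \<inter> L j"
      using f by (metis IntI)
    then show "i = j"
      using assms(2) by (auto simp: disjoint_family_on_def)
  qed
  moreover have "f ` active L \<subseteq> live L"
    using f by (auto simp: live_def)
  ultimately show ?thesis
    using assms(1) by (meson card_inj_on_le finite_imageD finite_subset)
qed

context
  fixes c C :: real and \<beta> :: nat and R :: "('k::linorder) levels set"
  assumes dec: "levelled_decomposition c C \<beta> R"
begin

lemma base_ge_2: "2 \<le> \<beta>"
  using dec by (simp add: levelled_decomposition_def)

lemma threshold_pos: "0 < c"
  using dec by (simp add: levelled_decomposition_def)

lemma state:
  assumes "L \<in> R"
  shows "levelled_state c C \<beta> L"
  using dec assms by (simp add: levelled_decomposition_def)

lemma finite_live: "L \<in> R \<Longrightarrow> finite (live L)"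
  using state by (auto simp: levelled_state_def)

lemma card_active_le:
  assumes "L \<in> R"
  shows "finite (active L)" "card (active L) \<le> card (live L)"
  using card_active_le_card_live[of L] state[OF assms] by (auto simp: levelled_state_def)

lemma rename_keys:
  assumes "L \<in> R" "bij \<pi>"
  shows "(\<lambda>i. \<pi> ` L i) \<in> R"
  using dec assms by (simp add: levelled_decomposition_def)

lemma ex_active_atMost: "\<exists>L\<in>R. active L = {..h}"
  using dec by (simp add: levelled_decomposition_def)

text \<open>The least key of the type, if there is one, may be live, so a key below all live keys
  need not exist for \<open>L\<close> itself. Swapping some dead key \<open>y\<close>, which exists
  in an infinite type, with the minimum \<open>q\<close> of \<open>insert y (live L)\<close> turns
  the live set into that set without \<open>q\<close>. If \<open>y\<close> is already that minimum,
  the swap is the identity.\<close>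

lemma ex_key_below_all_live:
  assumes "infinite (UNIV :: 'k set)" "L \<in> R"
  obtains L' q where "L' \<in> R" "active L' = active L" "card (live L') = card (live L)"
    "\<And>x. x \<in> live L' \<Longrightarrow> q < x"
proof -
  have fin: "finite (live L)"
    using assms(2) by (rule finite_live)
  then obtain y where y: "y \<notin> live L"
    using assms(1) ex_new_if_finite by blast
  define q where "q = Min (insert y (live L))"
  define \<pi> where "\<pi> = transpose y q"
  have "q \<in> insert y (live L)"
    unfolding q_def using fin by (intro Min_in) auto
  moreover have "q \<le> x" if "x \<in> insert y (live L)" for x
    unfolding q_def using fin that by (intro Min_le) auto
  ultimately have below: "q < x" if "x \<in> \<pi> ` live L" for x
    using that y unfolding \<pi>_def
    by (auto simp: transpose_def order.strict_iff_order split: if_splits)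
  have "bij \<pi>"
    by (simp add: \<pi>_def)
  then have "card (\<pi> ` live L) = card (live L)"
    by (intro card_image) (meson bij_is_inj inj_on_subset subset_UNIV)
  then show thesis
    using that[of "\<lambda>i. \<pi> ` L i" q] rename_keys[OF assms(2) \<open>bij \<pi>\<close>] below
    by (simp add: live_image active_image)
qed

lemma inspects_active_below_all_live:
  assumes "exact p R S" "depends_on_inspected R S" "L \<in> R"
    and below: "\<And>x. x \<in> live L \<Longrightarrow> q < x"
  shows "active L \<subseteq> inspected S L q"
proof
  fix i assume "i \<in> active L"
  then obtain x where x: "x \<in> L i"
    by (auto simp: active_def)
  show "i \<in> inspected S L q"
  proof (rule ccontr)
    assume not_inspected: "i \<notin> inspected S L q"
    define \<pi> where "\<pi> = transpose x q"
    define L' where "L' = (\<lambda>j. \<pi> ` L j)"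
    have "bij \<pi>"
      by (simp add: \<pi>_def)
    then have L': "L' \<in> R"
      unfolding L'_def using assms(3) by (rule rename_keys[rotated])
    have q: "q \<notin> L j" for j
      using below by (auto simp: live_def)
    \<comment> \<open>The swap moves only \<open>x\<close> and \<open>q\<close>: by disjointness
      \<open>x\<close> lies in level \<open>i\<close> alone, and \<open>q\<close> is dead.\<close>
    have same: "L j = L' j" if "j \<noteq> i" for j
    proof -
      have "disjoint_family L"
        using state[OF assms(3)] by (simp add: levelled_state_def)
      then have "x \<notin> L j"
        using that x by (auto simp: disjoint_family_on_def)
      then have "\<pi> y = y" if "y \<in> L j" for y
        using q that by (metis \<pi>_def transpose_apply_other)
      then show ?thesis
        by (simp add: L'_def)
    qed
    have "card (L j) = card (L' j)" for j
      unfolding L'_def using \<open>bij \<pi>\<close>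
      by (metis bij_is_inj card_image inj_on_subset subset_UNIV)
    then have "answer S L' q = answer S L q"
      using assms(2,3) L' same not_inspected unfolding depends_on_inspected_def by metis
    then have eq: "correct_answer p (live L') q = correct_answer p (live L) q"
      using assms(1,3) L' by (simp add: exact_def)
    have none: "{y \<in> live L. y \<le> q} = {}"
      using below by force
    have "q \<in> live L'"
      unfolding L'_def live_def \<pi>_def using x by (force simp: image_iff)
    then have some: "q \<in> {y \<in> live L'. y \<le> q}"
      by simp
    moreover have "finite {y \<in> live L'. y \<le> q}"
      using finite_live[OF L'] by simp
    ultimately have "card {y \<in> live L'. y \<le> q} > 0"
      using card_gt_0_iff by blast
    \<comment> \<open>The two correct answers differ: \<open>None\<close> against
      \<open>Some\<close> for predecessor, 0 against a positive number for rank.\<close>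
    then show False
      using eq none some by (cases p) (auto split: if_splits)
  qed
qed

text \<open>The number of live keys is kept because \<open>overhead\<close> ranges over states of
  bounded size.\<close>

lemma ex_all_inspected:
  assumes "infinite (UNIV :: 'k set)" "exact p R S" "depends_on_inspected R S" "L \<in> R"
  obtains L' q where "L' \<in> R" "active L' = active L" "card (live L') = card (live L)"
    "active L' \<subseteq> inspected S L' q"
  using ex_key_below_all_live[OF assms(1,4)] inspects_active_below_all_live[OF assms(2,3)]
  by metis

section \<open>Height and overhead\<close>

lemma bdd_above_height: "bdd_above {h. \<exists>L\<in>R. card (live L) \<le> n \<and> active L = {..h}}"
proof (rule bdd_aboveI)
  fix h assume "h \<in> {h. \<exists>L\<in>R. card (live L) \<le> n \<and> active L = {..h}}"
  then obtain L where "L \<in> R" "card (live L) \<le> n" "active L = {..h}"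
    by auto
  then show "h \<le> n"
    using card_active_le(2)[of L] by simp
qed

lemma bdd_above_overhead:
  "bdd_above {card (inspected S L q \<inter> active L) - 1 | L q. L \<in> R \<and> card (live L) \<le> n}"
proof (rule bdd_aboveI)
  fix k assume "k \<in> {card (inspected S L q \<inter> active L) - 1 | L q. L \<in> R \<and> card (live L) \<le> n}"
  then obtain L q where L: "L \<in> R" "card (live L) \<le> n"
    and k: "k = card (inspected S L q \<inter> active L) - 1"
    by auto
  have "card (inspected S L q \<inter> active L) \<le> card (active L)"
    using card_active_le(1)[OF L(1)] by (intro card_mono) auto
  then show "k \<le> n"
    using card_active_le(2)[OF L(1)] L(2) k by linarith
qed

lemma le_height:
  assumes "L \<in> R" "card (live L) \<le> n" "active L = {..h}"
  shows "h \<le> height R n"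
  unfolding height_def using assms by (intro cSup_upper bdd_above_height) auto

text \<open>The height is \<open>0\<close>, the supremum of the empty set, if \<open>n\<close> is too small.\<close>

lemma height_cases:
  obtains "height R n = 0"
  | L where "L \<in> R" "card (live L) \<le> n" "active L = {..height R n}"
proof (cases "{h. \<exists>L\<in>R. card (live L) \<le> n \<and> active L = {..h}} = {}")
  case True
  then have "height R n = 0"
    by (simp only: height_def Sup_nat_empty)
  then show thesis
    by (rule that(1))
next
  case False
  \<comment> \<open>A bounded set of naturals is finite, so its supremum is a maximum and is
    attained.\<close>
  then have "height R n \<in> {h. \<exists>L\<in>R. card (live L) \<le> n \<and> active L = {..h}}"
    using bdd_above_height[of n] Max_in[OF _ False]
    by (simp only: height_def Sup_nat_def bdd_above_nat if_False)
  then show thesis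
    using that(2) by blast
qed

lemma height_le_overhead:
  assumes "infinite (UNIV :: 'k set)" "exact p R S" "depends_on_inspected R S"
  shows "height R n \<le> overhead R S n"
proof (rule height_cases[of n])
  fix L assume L: "L \<in> R" "card (live L) \<le> n" "active L = {..height R n}"
  obtain L' q where L': "L' \<in> R" "active L' = active L" "card (live L') = card (live L)"
    "active L' \<subseteq> inspected S L' q"
    using ex_all_inspected[OF assms L(1)] .
  \<comment> \<open>The set \<open>{..h}\<close> has \<open>h + 1\<close> elements, and
    \<open>overhead\<close> does not count the first inspection.\<close>
  then have "height R n = card (inspected S L' q \<inter> active L') - 1"
    using L(3) by (simp add: Int_absorb1)
  then have "height R n \<in> {card (inspected S L q \<inter> active L) - 1 | L q. L \<in> R \<and> card (live L) \<le> n}"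
    using L(2) L'(1,3) by (intro CollectI exI[of _ L'] exI[of _ q]) simp
  then show ?thesis
    unfolding overhead_def by (intro cSup_upper bdd_above_overhead)
qed simp

text \<open>The threshold for using the top level gives \<open>c * \<beta>^h \<le> n\<close>; take
  logarithms. Since \<open>\<beta>\<close> is at least 2, passing to base 2 bounds the error by a
  constant independent of \<open>\<beta>\<close>.\<close>

lemma height_le_log:
  assumes "0 \<le> log \<beta> n"
  shows "height R n \<le> log \<beta> n + \<bar>log 2 c\<bar>"
proof (rule height_cases[of n])
  assume "height R n = 0"
  then show ?thesis
    using assms by simp
next
  fix L assume L: "L \<in> R" "card (live L) \<le> n" "active L = {..height R n}"
  have b: "1 < real \<beta>"
    using base_ge_2 by simp
  have "c * real \<beta> ^ height R n \<le> card (live L)"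
    using state[OF L(1)] L(3) by (simp add: levelled_state_def)
  also have "\<dots> \<le> n"
    using L(2) by simp
  finally have le: "c * real \<beta> ^ height R n \<le> n" .
  have pos: "0 < c * real \<beta> ^ height R n"
    using threshold_pos b by simp
  have "log \<beta> (c * real \<beta> ^ height R n) \<le> log \<beta> n"
    using le pos b by (intro log_mono) auto
  moreover have "log \<beta> (c * real \<beta> ^ height R n) = log \<beta> c + height R n"
    using threshold_pos b by (simp add: log_mult log_nat_power)
  moreover have "\<bar>log \<beta> c\<bar> \<le> \<bar>log 2 c\<bar>"
    using base_ge_2 by (auto simp: log_def abs_divide intro!: divide_left_mono)
  ultimately show ?thesis
    by linarith
qed

text \<open>Sum the level capacities as a geometric series. No sign is assumed for \<open>C\<close>;
  \<open>max C 1\<close> keeps the factor positive and its logarithm nonnegative.\<close>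

lemma card_live_le:
  assumes "L \<in> R" "active L = {..h}"
  shows "card (live L) \<le> max C 1 * real \<beta> ^ (h + 2)"
proof -
  have b: "2 \<le> real \<beta>"
    using base_ge_2 by simp
  have live: "live L = (\<Union>i\<le>h. L i)"
    using assms(2) by (auto simp: live_def active_def)
  \<comment> \<open>For base at least 2, each power dominates the sum of the preceding ones, so no
    further constant arises.\<close>
  have geometric: "(\<Sum>i\<le>h. real \<beta> ^ (i + 1)) \<le> real \<beta> ^ (h + 2)" for h
  proof (induction h)
    case 0
    then show ?case
      using b by (simp add: self_le_power)
  next
    case (Suc h)
    then have "(\<Sum>i\<le>Suc h. real \<beta> ^ (i + 1)) \<le> 2 * real \<beta> ^ (h + 2)"
      by simp
    also have "\<dots> \<le> real \<beta> * real \<beta> ^ (h + 2)"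
      using b by (intro mult_right_mono) auto
    finally show ?case
      by simp
  qed
  have "real (card (live L)) \<le> (\<Sum>i\<le>h. real (card (L i)))"
    unfolding live by (metis card_UN_le finite_atMost of_nat_mono of_nat_sum)
  also have "\<dots> \<le> (\<Sum>i\<le>h. max C 1 * real \<beta> ^ (i + 1))"
  proof (rule sum_mono)
    fix i
    have "real (card (L i)) \<le> C * real \<beta> ^ (i + 1)"
      using state[OF assms(1)] by (simp add: levelled_state_def)
    also have "\<dots> \<le> max C 1 * real \<beta> ^ (i + 1)"
      by (intro mult_right_mono) auto
    finally show "real (card (L i)) \<le> max C 1 * real \<beta> ^ (i + 1)" .
  qed
  also have "\<dots> = max C 1 * (\<Sum>i\<le>h. real \<beta> ^ (i + 1))"
    by (simp only: sum_distrib_left)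
  also have "\<dots> \<le> max C 1 * real \<beta> ^ (h + 2)"
    using geometric by (intro mult_left_mono) auto
  finally show ?thesis .
qed

text \<open>A state with \<open>h + 1\<close> active levels has at most \<open>n\<close> live keys
  as soon as \<open>D * \<beta>^(h+2) \<le> n\<close>, where \<open>D = max C 1\<close>. In the
  constant 3, the exponent \<open>h + 2\<close> accounts for 2 and rounding \<open>h\<close> down
  for 1.\<close>

lemma log_le_height:
  assumes "3 + log 2 (max C 1) \<le> log \<beta> n"
  shows "log \<beta> n - (3 + log 2 (max C 1)) \<le> height R n"
proof -
  define D where "D = max C 1"
  define h where "h = nat \<lfloor>log \<beta> n - 2 - log 2 D\<rfloor>"
  have D: "1 \<le> D"
    by (simp add: D_def)
  have b: "1 < real \<beta>"
    using base_ge_2 by simp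
  have "0 \<le> log 2 D"
    using D by simp
  then have "0 < log \<beta> n"
    using assms unfolding D_def by linarith
  \<comment> \<open>The convention \<open>ln 0 = 0\<close> makes the logarithm vanish at
    \<open>n = 0\<close>, which excludes that case.\<close>
  then have n: "0 < real n"
    by (cases "n = 0") (auto simp: log_def)
  have h: "h \<le> log \<beta> n - 2 - log 2 D" "log \<beta> n - 3 - log 2 D \<le> h"
    using assms unfolding h_def D_def by linarith+
  have "log \<beta> D \<le> log 2 D"
    using base_ge_2 D by (auto simp: log_def intro!: divide_left_mono)
  then have "log \<beta> (D * real \<beta> ^ (h + 2)) \<le> log \<beta> n"
    using h(1) D b by (simp add: log_mult log_nat_power del: power_Suc power_add)
  then have "D * real \<beta> ^ (h + 2) \<le> n"
    using b D n by (subst (asm) log_le_cancel_iff) auto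
  moreover obtain L where L: "L \<in> R" "active L = {..h}"
    using ex_active_atMost by blast
  ultimately have "real (card (live L)) \<le> real n"
    using card_live_le[OF L] unfolding D_def by linarith
  then have "h \<le> height R n"
    using L by (intro le_height) auto
  then show ?thesis
    using h(2) by (simp add: D_def)
qed

end

section \<open>Asymptotics\<close>

lemma eventually_many_levels_base: "\<forall>\<^sub>F (\<beta>, n) in many_levels B. \<beta> \<in> B"
  unfolding many_levels_def eventually_inf_principal by (intro always_eventually) auto

lemma eventually_many_levels_ge: "\<forall>\<^sub>F (\<beta>, n) in many_levels B. M \<le> log (real \<beta>) (real n)"
proof -
  have "\<forall>\<^sub>F x in filtercomap (\<lambda>(\<beta>, n). log (real \<beta>) (real n)) at_top.
      M \<le> (case x of (\<beta>, n) \<Rightarrow> log (real \<beta>) (real n))"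
    by (intro eventually_filtercomapI eventually_ge_at_top)
  then show ?thesis
    unfolding many_levels_def eventually_inf_principal by eventually_elim auto
qed

lemma height_bigtheta_log:
  assumes "\<And>\<beta>. \<beta> \<in> B \<Longrightarrow> levelled_decomposition c C \<beta> (R \<beta>)"
  shows "(\<lambda>(\<beta>, n). real (height (R \<beta>) n)) \<in>
    \<Theta>[many_levels B](\<lambda>(\<beta>, n). log (real \<beta>) (real n))"
proof (rule bigthetaI)
  define M where "M = 3 + log 2 (max C 1)"
  have M: "0 \<le> M"
    unfolding M_def by simp
  show "(\<lambda>(\<beta>, n). real (height (R \<beta>) n)) \<in>
    O[many_levels B](\<lambda>(\<beta>, n). log (real \<beta>) (real n))"
  \<comment> \<open>Once the logarithm is at least \<open>\<bar>log 2 c\<bar>\<close>, it absorbs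
    this additive error.\<close>
  proof (rule bigoI[where c = 2])
    show "\<forall>\<^sub>F x in many_levels B. norm (case x of (\<beta>, n) \<Rightarrow> real (height (R \<beta>) n))
        \<le> 2 * norm (case x of (\<beta>, n) \<Rightarrow> log (real \<beta>) (real n))"
      using eventually_many_levels_base eventually_many_levels_ge[of "\<bar>log 2 c\<bar>"]
    proof eventually_elim
      case (elim x)
      obtain \<beta> n where x: "x = (\<beta>, n)" by fastforce
      have "height (R \<beta>) n \<le> log \<beta> n + \<bar>log 2 c\<bar>"
        using elim by (intro height_le_log[OF assms]) (auto simp: x)
      then show ?case
        using elim by (simp add: x)
    qed
  qed
  show "(\<lambda>(\<beta>, n). real (height (R \<beta>) n)) \<in>
    \<Omega>[many_levels B](\<lambda>(\<beta>, n). log (real \<beta>) (real n))"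
  \<comment> \<open>Once the logarithm is at least \<open>2 * M\<close>, subtracting
    \<open>M\<close> leaves at least half of it.\<close>
  proof (rule landau_omega.bigI[where c = "1 / 2"])
    show "\<forall>\<^sub>F x in many_levels B. norm (case x of (\<beta>, n) \<Rightarrow> real (height (R \<beta>) n))
        \<ge> 1 / 2 * norm (case x of (\<beta>, n) \<Rightarrow> log (real \<beta>) (real n))"
      using eventually_many_levels_base eventually_many_levels_ge[of "2 * M"]
    proof eventually_elim
      case (elim x)
      obtain \<beta> n where x: "x = (\<beta>, n)" by fastforce
      have "log \<beta> n - M \<le> height (R \<beta>) n"
        using elim M by (intro log_le_height[OF assms, folded M_def]) (auto simp: x)
      then show ?case
        using elim M by (simp add: x)
    qed
  qed simp
qed

theorem theorem4:
  fixes p :: problem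
    and c C :: real
    and B :: "nat set"
    and R :: "nat \<Rightarrow> ('k::linorder) levels set"
    and S :: "nat \<Rightarrow> 'k query_structure"
  assumes "infinite (UNIV :: 'k set)"
    and "\<And>\<beta>. \<beta> \<in> B \<Longrightarrow> levelled_decomposition c C \<beta> (R \<beta>)"
    and "\<And>\<beta>. \<beta> \<in> B \<Longrightarrow> exact p (R \<beta>) (S \<beta>)"
    and "\<And>\<beta>. \<beta> \<in> B \<Longrightarrow> depends_on_inspected (R \<beta>) (S \<beta>)"
  shows "(\<forall>\<beta>\<in>B. \<forall>h. \<exists>L\<in>R \<beta>. \<exists>q. active L = {..h} \<and> {..h} \<subseteq> inspected (S \<beta>) L q) \<and>
    (\<lambda>(\<beta>, n). real (overhead (R \<beta>) (S \<beta>) n)) \<in>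
      \<Omega>[many_levels B](\<lambda>(\<beta>, n). real (height (R \<beta>) n)) \<and>
    \<Omega>[many_levels B](\<lambda>(\<beta>, n). real (height (R \<beta>) n)) =
      \<Omega>[many_levels B](\<lambda>(\<beta>, n). log (real \<beta>) (real n))"
proof (intro conjI ballI allI)
  fix \<beta> h assume \<beta>: "\<beta> \<in> B"
  obtain L where L: "L \<in> R \<beta>" "active L = {..h}"
    using ex_active_atMost[OF assms(2)[OF \<beta>]] by blast
  obtain L' q where "L' \<in> R \<beta>" "active L' = active L" "active L' \<subseteq> inspected (S \<beta>) L' q"
    using ex_all_inspected[OF assms(2)[OF \<beta>] assms(1) assms(3,4)[OF \<beta>] L(1)] .
  then show "\<exists>L\<in>R \<beta>. \<exists>q. active L = {..h} \<and> {..h} \<subseteq> inspected (S \<beta>) L q"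
    using L(2) by auto
next
  show "(\<lambda>(\<beta>, n). real (overhead (R \<beta>) (S \<beta>) n)) \<in>
      \<Omega>[many_levels B](\<lambda>(\<beta>, n). real (height (R \<beta>) n))"
  proof (rule landau_omega.bigI[where c = 1])
    show "\<forall>\<^sub>F x in many_levels B. norm (case x of (\<beta>, n) \<Rightarrow> real (overhead (R \<beta>) (S \<beta>) n))
        \<ge> 1 * norm (case x of (\<beta>, n) \<Rightarrow> real (height (R \<beta>) n))"
      using eventually_many_levels_base
      by eventually_elim (auto intro: height_le_overhead[OF assms(2) assms(1) assms(3,4)])
  qed simp
next
  show "\<Omega>[many_levels B](\<lambda>(\<beta>, n). real (height (R \<beta>) n)) =
      \<Omega>[many_levels B](\<lambda>(\<beta>, n). log (real \<beta>) (real n))"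
    by (intro landau_omega.big.cong_bigtheta height_bigtheta_log[OF assms(2)])
qed

end
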